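(* Consider the robust access allocation problem (R) defined in the context and let $(\underline{\mathbf C}^\star,\overline{\mathbf C}^\star,\overline{\mathbf P}^\star,\underline{\mathbf P}^\star)$ together with multipliers $(\overline{\boldsymbol\eta}^\star,\underline{\boldsymbol\eta}^\star,\overline{\boldsymbol\omega}^\star,\underline{\boldsymbol\omega}^\star,\overline{\boldsymbol\lambda}^\star,\underline{\boldsymbol\lambda}^\star,\overline{\boldsymbol\mu}^\star,\underline{\boldsymbol\mu}^\star)$ be a primal-dual optimal solution. Then the access prices (LMAP-R) $\overline{\boldsymbol\lambda}^\star,\underline{\boldsymbol\lambda}^\star\in\mathbb{R}^N$ satisfy $$\overline{\boldsymbol\lambda}^\star=\nabla_{\overline{\mathbf P}}J(\overline{\mathbf P}^\star,\underline{\mathbf P}^\star)+\mathbf A_+^{\top}\overline{\boldsymbol\mu}^\star+\mathbf A_-^{\top}\underline{\boldsymbol\mu}^\star+\overline{\boldsymbol\omega}^\star,$$ $$\underline{\boldsymbol\lambda}^\star=\nabla_{\underline{\mathbf P}}J(\overline{\mathbf P}^\star,\underline{\mathbf P}^\star)+\mathbf A_-^{\top}\overline{\boldsymbol\mu}^\star+\mathbf A_+^{\top}\underline{\boldsymbol\mu}^\star+\underline{\boldsymbol\omega}^\star.$$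
   Context: All vector inequalities are element-wise. For a scalar $z$, $z_+:=\max\{z,0\}$, $z_-:=z_+-z$, applied element-wise to matrices, so $\mathbf A=\mathbf A_+-\mathbf A_-$. Problem (R). Data: positive integers $K,N,M$; $\mathbf A\in\mathbb{R}^{M\times N}$; $\underline{\mathbf b},\overline{\mathbf b}\in\mathbb{R}^M$; element-wise nonnegative $\overline{\mathbf C}_k^{\min},\underline{\mathbf C}_k^{\min},\overline{\mathbf P}^{\max},\underline{\mathbf P}^{\max}\in\mathbb{R}^N$; $\overline{\mathbf p}_0,\underline{\mathbf p}_0\in\mathbb{R}^N$ with $-\underline{\mathbf p}_0\le\overline{\mathbf p}_0$; concave non-decreasing $\varphi_k:\mathbb{R}^{2N}\to\mathbb{R}$, $k=1,\dots,K$; convex non-decreasing differentiable $J:\mathbb{R}^{2N}\to\mathbb{R}$. Over $\overline{\mathbf C}_k,\underline{\mathbf C}_k,\overline{\mathbf P},\underline{\mathbf P}\in\mathbb{R}^N$, maximize $\sum_{k=1}^K\varphi_k(\underline{\mathbf C}_k,\overline{\mathbf C}_k)-J(\overline{\mathbf P},\underline{\mathbf P})$ subject to (multipliers in brackets) - $[\overline{\boldsymbol\eta}_k,\underline{\boldsymbol\eta}_k\ge0]$: $\overline{\mathbf C}_k^{\min}\le\overline{\mathbf C}_k$, $\underline{\mathbf C}_k^{\min}\le\underline{\mathbf C}_k$ for each $k$; - $[\overline{\boldsymbol\omega},\underline{\boldsymbol\omega}\ge0]$: $\overline{\mathbf P}\le\overline{\mathbf P}^{\max}$, $\underline{\mathbf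 P}\le\underline{\mathbf P}^{\max}$; - $[\overline{\boldsymbol\lambda},\underline{\boldsymbol\lambda}\text{ free}]$: $\overline{\mathbf P}=\sum_k\overline{\mathbf C}_k+\overline{\mathbf p}_0$, $\underline{\mathbf P}=\sum_k\underline{\mathbf C}_k+\underline{\mathbf p}_0$; - $[\overline{\boldsymbol\mu}\ge0]$: $\mathbf A_+\overline{\mathbf P}+\mathbf A_-\underline{\mathbf P}\le\overline{\mathbf b}$; - $[\underline{\boldsymbol\mu}\ge0]$: $\underline{\mathbf b}\le-\mathbf A_+\underline{\mathbf P}-\mathbf A_-\overline{\mathbf P}$. The Lagrangian (sign convention) is $$\mathcal L=J(\overline{\mathbf P},\underline{\mathbf P})-\sum_k\varphi_k(\underline{\mathbf C}_k,\overline{\mathbf C}_k)+\overline{\boldsymbol\lambda}^\top\Big(\sum_k\overline{\mathbf C}_k+\overline{\mathbf p}_0-\overline{\mathbf P}\Big)+\underline{\boldsymbol\lambda}^\top\Big(\sum_k\underline{\mathbf C}_k+\underline{\mathbf p}_0-\underline{\mathbf P}\Big)+\sum_k\overline{\boldsymbol\eta}_k^\top(\overline{\mathbf C}_k^{\min}-\overline{\mathbf C}_k)+\sum_k\underline{\boldsymbol\eta}_k^\top(\underline{\mathbf C}_k^{\min}-\underline{\mathbf C}_k)$$ $$+\overline{\boldsymbol\mu}^\top(\mathbf A_+\overline{\mathbf P}+\mathbf A_-\underline{\mathbf P}-\overline{\mathbf b})+\underline{\boldsymbol\mu}^\top(\mathbf A_+\underline{\mathbf P}+\mathbf A_-\overline{\mathbf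 P}+\underline{\mathbf b})+\overline{\boldsymbol\omega}^\top(\overline{\mathbf P}-\overline{\mathbf P}^{\max})+\underline{\boldsymbol\omega}^\top(\underline{\mathbf P}-\underline{\mathbf P}^{\max}).$$ A primal-dual optimal solution means: the primal point is feasible, the inequality multipliers are nonnegative, complementary slackness holds for every inequality constraint, and the primal point minimizes $\mathcal L$ (at the given multipliers) over all $\overline{\mathbf C}_k,\underline{\mathbf C}_k,\overline{\mathbf P},\underline{\mathbf P}\in\mathbb{R}^N$. The locational marginal access prices (LMAP-R) are the components $\overline{\boldsymbol\lambda}^\star,\underline{\boldsymbol\lambda}^\star$. $\nabla_{\overline{\mathbf P}}J$ and $\nabla_{\underline{\mathbf P}}J$ are the partial gradients of $J(\overline{\mathbf P},\underline{\mathbf P})$ in its first and second $N$-vector arguments. *)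

theory Defs
  imports "HOL-Analysis.Analysis"
begin

text \<open>
  Overlined and underlined quantities carry the suffixes \<open>_up\<close> and \<open>_dn\<close>. The dimensions
  \<open>K, N, M\<close> are the cardinalities of the index types \<open>'k, 'n, 'm\<close>, and \<open>\<real>\<close> to the power
  \<open>2N\<close> is \<open>real^'n \<times> real^'n\<close>. The library orders on vectors and on pairs are both
  component-wise, so \<open>\<le>\<close> is element-wise and \<open>mono\<close> is monotonicity in every coordinate.
\<close>

definition pos_part :: "real \<Rightarrow> real" where
  "pos_part z = max z 0"

definition neg_part :: "real \<Rightarrow> real" where
  "neg_part z = pos_part z - z"

definition pos_mat :: "real^'n^'m \<Rightarrow> real^'n^'m" where
  "pos_mat A = (\<chi> i j. pos_part (A $ i $ j))"

definition neg_mat :: "real^'n^'m \<Rightarrow> real^'n^'m" where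
  "neg_mat A = (\<chi> i j. neg_part (A $ i $ j))"

text \<open>Unspecified where \<open>f\<close> is not differentiable.\<close>

definition gradient :: "('a::real_inner \<Rightarrow> real) \<Rightarrow> 'a \<Rightarrow> 'a" where
  "gradient f x = (THE d. GDERIV f x :> d)"

text \<open>
  \<open>util k\<close> is the utility \<open>\<phi>\<close> of index \<open>k\<close>, with the underlined argument first;
  \<open>cost\<close> is \<open>J\<close>, with the overlined argument first.
\<close>

record ('k, 'n::finite, 'm::finite) access_problem =
  netA :: "real^'n^'m"
  b_dn :: "real^'m"
  b_up :: "real^'m"
  Cmin_up :: "'k \<Rightarrow> real^'n"
  Cmin_dn :: "'k \<Rightarrow> real^'n"
  Pmax_up :: "real^'n"
  Pmax_dn :: "real^'n"
  p0_up :: "real^'n"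
  p0_dn :: "real^'n"
  util :: "'k \<Rightarrow> (real^'n) \<times> (real^'n) \<Rightarrow> real"
  cost :: "(real^'n) \<times> (real^'n) \<Rightarrow> real"

record ('k, 'n::finite) allocation =
  C_up :: "'k \<Rightarrow> real^'n"
  C_dn :: "'k \<Rightarrow> real^'n"
  P_up :: "real^'n"
  P_dn :: "real^'n"

record ('k, 'n::finite, 'm::finite) multipliers =
  eta_up :: "'k \<Rightarrow> real^'n"
  eta_dn :: "'k \<Rightarrow> real^'n"
  omega_up :: "real^'n"
  omega_dn :: "real^'n"
  lambda_up :: "real^'n"
  lambda_dn :: "real^'n"
  mu_up :: "real^'m"
  mu_dn :: "real^'m"

definition admissible_data :: "('k::finite, 'n::finite, 'm::finite) access_problem \<Rightarrow> bool" where
  "admissible_data D \<longleftrightarrow>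
     (\<forall>k. 0 \<le> Cmin_up D k \<and> 0 \<le> Cmin_dn D k) \<and>
     0 \<le> Pmax_up D \<and> 0 \<le> Pmax_dn D \<and>
     - p0_dn D \<le> p0_up D \<and>
     (\<forall>k. concave_on UNIV (util D k) \<and> mono (util D k)) \<and>
     convex_on UNIV (cost D) \<and> mono (cost D) \<and> cost D differentiable_on UNIV"

definition objective ::
    "('k::finite, 'n::finite, 'm::finite) access_problem \<Rightarrow> ('k, 'n) allocation \<Rightarrow> real" where
  "objective D x = (\<Sum>k\<in>UNIV. util D k (C_dn x k, C_up x k)) - cost D (P_up x, P_dn x)"

definition feasible ::
    "('k::finite, 'n::finite, 'm::finite) access_problem \<Rightarrow> ('k, 'n) allocation \<Rightarrow> bool" where
  "feasible D x \<longleftrightarrow>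
     (\<forall>k. Cmin_up D k \<le> C_up x k \<and> Cmin_dn D k \<le> C_dn x k) \<and>
     P_up x \<le> Pmax_up D \<and> P_dn x \<le> Pmax_dn D \<and>
     P_up x = (\<Sum>k\<in>UNIV. C_up x k) + p0_up D \<and>
     P_dn x = (\<Sum>k\<in>UNIV. C_dn x k) + p0_dn D \<and>
     pos_mat (netA D) *v P_up x + neg_mat (netA D) *v P_dn x \<le> b_up D \<and>
     b_dn D \<le> - (pos_mat (netA D) *v P_dn x) - neg_mat (netA D) *v P_up x"

text \<open>
  Problem (R) maximizes \<open>objective\<close> over \<open>feasible\<close> points; the Lagrangian is that of the
  equivalent minimization of the negated objective.
\<close>

definition lagrangian ::
    "('k::finite, 'n::finite, 'm::finite) access_problem \<Rightarrow> ('k, 'n, 'm) multipliers \<Rightarrow>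
     ('k, 'n) allocation \<Rightarrow> real" where
  "lagrangian D y x =
     - objective D x
     + lambda_up y \<bullet> ((\<Sum>k\<in>UNIV. C_up x k) + p0_up D - P_up x)
     + lambda_dn y \<bullet> ((\<Sum>k\<in>UNIV. C_dn x k) + p0_dn D - P_dn x)
     + (\<Sum>k\<in>UNIV. eta_up y k \<bullet> (Cmin_up D k - C_up x k))
     + (\<Sum>k\<in>UNIV. eta_dn y k \<bullet> (Cmin_dn D k - C_dn x k))
     + mu_up y \<bullet> (pos_mat (netA D) *v P_up x + neg_mat (netA D) *v P_dn x - b_up D)
     + mu_dn y \<bullet> (pos_mat (netA D) *v P_dn x + neg_mat (netA D) *v P_up x + b_dn D)
     + omega_up y \<bullet> (P_up x - Pmax_up D)
     + omega_dn y \<bullet> (P_dn x - Pmax_dn D)"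

definition dual_nonneg :: "('k::finite, 'n::finite, 'm::finite) multipliers \<Rightarrow> bool" where
  "dual_nonneg y \<longleftrightarrow>
     (\<forall>k. 0 \<le> eta_up y k \<and> 0 \<le> eta_dn y k) \<and>
     0 \<le> omega_up y \<and> 0 \<le> omega_dn y \<and> 0 \<le> mu_up y \<and> 0 \<le> mu_dn y"

definition complementary_slackness ::
    "('k::finite, 'n::finite, 'm::finite) access_problem \<Rightarrow> ('k, 'n) allocation \<Rightarrow>
     ('k, 'n, 'm) multipliers \<Rightarrow> bool" where
  "complementary_slackness D x y \<longleftrightarrow>
     (\<forall>k i. eta_up y k $ i * (Cmin_up D k - C_up x k) $ i = 0) \<and>
     (\<forall>k i. eta_dn y k $ i * (Cmin_dn D k - C_dn x k) $ i = 0) \<and>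
     (\<forall>i. omega_up y $ i * (P_up x - Pmax_up D) $ i = 0) \<and>
     (\<forall>i. omega_dn y $ i * (P_dn x - Pmax_dn D) $ i = 0) \<and>
     (\<forall>j. mu_up y $ j *
        (pos_mat (netA D) *v P_up x + neg_mat (netA D) *v P_dn x - b_up D) $ j = 0) \<and>
     (\<forall>j. mu_dn y $ j *
        (pos_mat (netA D) *v P_dn x + neg_mat (netA D) *v P_up x + b_dn D) $ j = 0)"

definition primal_dual_optimal ::
    "('k::finite, 'n::finite, 'm::finite) access_problem \<Rightarrow> ('k, 'n) allocation \<Rightarrow>
     ('k, 'n, 'm) multipliers \<Rightarrow> bool" where
  "primal_dual_optimal D x y \<longleftrightarrow>
     feasible D x \<and> dual_nonneg y \<and> complementary_slackness D x y \<and>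
     (\<forall>x'. lagrangian D y x \<le> lagrangian D y x')"

end

theory Submission
  imports Defs
begin

text \<open>
  For fixed multipliers and with every other primal variable frozen, the Lagrangian is, in each
  of the two aggregate vectors, the cost plus an affine function. The price formulas are the
  first-order conditions at its minimizer.
\<close>

text \<open>\<open>gradient\<close> is a definite description, so uniqueness is the point: the
  derivative of \<open>f\<close> at \<open>x\<close> is unique, and a vector is determined by its
  inner products with all \<open>h\<close>.\<close>

lemma gradient_eqI:
  assumes "GDERIV f x :> d"
  shows "gradient f x = d"
proof -
  have "e = d" if "GDERIV f x :> e" for e
  proof -
    have "(\<lambda>h. h \<bullet> e) = (\<lambda>h. h \<bullet> d)"
      using has_derivative_unique that assms unfolding gderiv_def by blast
    then have "h \<bullet> e = h \<bullet> d" for h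
      by (rule fun_cong)
    then show ?thesis
      by (subst vector_eq_ldot[symmetric]) blast
  qed
  with assms show ?thesis
    unfolding gradient_def by blast
qed

text \<open>Fermat's rule for \<open>f\<close> plus a linear term: the derivative
  \<open>f' h + d \<bullet> h\<close> vanishes identically at \<open>p\<close>, which exhibits
  \<open>- d\<close> as the vector representing \<open>f'\<close>.\<close>

lemma gradient_eq_uminus_if_minimizer:
  fixes f :: "'a::real_inner \<Rightarrow> real"
  assumes "f differentiable at p"
    and min: "\<And>q. f p + d \<bullet> p \<le> f q + d \<bullet> q"
  shows "gradient f p = - d"
proof -
  obtain f' where f': "(f has_derivative f') (at p)"
    using assms(1) unfolding differentiable_def by blast
  have "((\<lambda>q. f q + d \<bullet> q) has_derivative (\<lambda>h. f' h + d \<bullet> h)) (at p)"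
    by (intro derivative_intros f')
  then have "(\<lambda>h. f' h + d \<bullet> h) = (\<lambda>h. 0)"
    by (rule has_derivative_local_min) (simp add: min)
  then have "f' h = h \<bullet> (- d)" for h
    by (metis add_eq_0_iff2 inner_commute inner_minus_right)
  then have "f' = (\<lambda>h. h \<bullet> (- d))"
    by blast
  with f' show ?thesis
    by (intro gradient_eqI) (simp add: gderiv_def)
qed

text \<open>Moves each network matrix onto its multiplier, so that all linear terms in an aggregate
  vector share one coefficient.\<close>

lemma inner_matrix_vector_mult:
  fixes A :: "real^'n^'m"
  shows "u \<bullet> (A *v v) = (transpose A *v u) \<bullet> v"
  by (simp add: dot_lmul_matrix)

text \<open>All constraint terms are affine in \<open>P_up\<close>, so constants and terms in the
  other variables cancel exactly. The price enters with a minus sign because the balance term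
  contains \<open>- P_up x\<close>.\<close>

lemma lagrangian_P_up_update:
  "lagrangian D y (x\<lparr>P_up := P\<rparr>) - lagrangian D y x =
     cost D (P, P_dn x) - cost D (P_up x, P_dn x)
     + (transpose (pos_mat (netA D)) *v mu_up y + transpose (neg_mat (netA D)) *v mu_dn y
        + omega_up y - lambda_up y) \<bullet> (P - P_up x)"
  unfolding lagrangian_def objective_def
  by (simp add: inner_diff_left inner_add_left inner_diff_right inner_add_right
      inner_matrix_vector_mult del: transpose_matrix_vector)

text \<open>The two matrices trade places, since \<open>P_dn\<close> enters the upper limit through
  \<open>neg_mat\<close> and the lower one through \<open>pos_mat\<close>.\<close>

lemma lagrangian_P_dn_update:
  "lagrangian D y (x\<lparr>P_dn := P\<rparr>) - lagrangian D y x =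
     cost D (P_up x, P) - cost D (P_up x, P_dn x)
     + (transpose (neg_mat (netA D)) *v mu_up y + transpose (pos_mat (netA D)) *v mu_dn y
        + omega_dn y - lambda_dn y) \<bullet> (P - P_dn x)"
  unfolding lagrangian_def objective_def
  by (simp add: inner_diff_left inner_add_left inner_diff_right inner_add_right
      inner_matrix_vector_mult del: transpose_matrix_vector)

theorem proposition1:
  fixes D :: "('k::finite, 'n::finite, 'm::finite) access_problem"
    and x :: "('k, 'n) allocation"
    and y :: "('k, 'n, 'm) multipliers"
  assumes "admissible_data D"
    and "primal_dual_optimal D x y"
  shows "lambda_up y =
           gradient (\<lambda>P. cost D (P, P_dn x)) (P_up x)
           + transpose (pos_mat (netA D)) *v mu_up y
           + transpose (neg_mat (netA D)) *v mu_dn y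
           + omega_up y
       \<and> lambda_dn y =
           gradient (\<lambda>P. cost D (P_up x, P)) (P_dn x)
           + transpose (neg_mat (netA D)) *v mu_up y
           + transpose (pos_mat (netA D)) *v mu_dn y
           + omega_dn y"
proof -
  let ?d_up = "transpose (pos_mat (netA D)) *v mu_up y + transpose (neg_mat (netA D)) *v mu_dn y
    + omega_up y - lambda_up y"
  let ?d_dn = "transpose (neg_mat (netA D)) *v mu_up y + transpose (pos_mat (netA D)) *v mu_dn y
    + omega_dn y - lambda_dn y"
  have min: "lagrangian D y x \<le> lagrangian D y x'" for x'
    using assms(2) unfolding primal_dual_optimal_def by blast
  have diff: "cost D differentiable at p" for p
    using assms(1) unfolding admissible_data_def differentiable_on_def by blast
  \<comment> \<open>The section inherits differentiability by composing \<open>cost D\<close> with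
    the affine map \<open>P \<mapsto> (P, P_dn x)\<close>.\<close>
  have "(\<lambda>P. cost D (P, P_dn x)) differentiable at (P_up x)"
    by (rule differentiable_compose[where f = "cost D", OF diff])
      (auto simp: differentiable_def intro!: exI derivative_eq_intros)
  \<comment> \<open>The comparison point may violate the balance equation: the Lagrangian is
    minimized over all allocations, so \<open>P\<close> ranges freely.\<close>
  moreover have "cost D (P_up x, P_dn x) + ?d_up \<bullet> P_up x \<le> cost D (P, P_dn x) + ?d_up \<bullet> P" for P
    using min[of "x\<lparr>P_up := P\<rparr>"] lagrangian_P_up_update[of D y P x]
    by (simp only: inner_diff_right)
  ultimately have up: "gradient (\<lambda>P. cost D (P, P_dn x)) (P_up x) = - ?d_up"
    by (rule gradient_eq_uminus_if_minimizer)
  have "(\<lambda>P. cost D (P_up x, P)) differentiable at (P_dn x)"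
    by (rule differentiable_compose[where f = "cost D", OF diff])
      (auto simp: differentiable_def intro!: exI derivative_eq_intros)
  moreover have "cost D (P_up x, P_dn x) + ?d_dn \<bullet> P_dn x \<le> cost D (P_up x, P) + ?d_dn \<bullet> P" for P
    using min[of "x\<lparr>P_dn := P\<rparr>"] lagrangian_P_dn_update[of D y P x]
    by (simp only: inner_diff_right)
  ultimately have dn: "gradient (\<lambda>P. cost D (P_up x, P)) (P_dn x) = - ?d_dn"
    by (rule gradient_eq_uminus_if_minimizer)
  \<comment> \<open>Once the gradients are replaced by \<open>- ?d_up\<close> and
    \<open>- ?d_dn\<close>, everything but the price cancels on each right-hand side.\<close>
  show ?thesis
    unfolding up dn by (simp add: algebra_simps)
qed

end
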